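(* Suppose $X_1,\dots,X_n$ are i.i.d. $\mathrm{Exp}(\theta)$ with rate $\theta>0$. For any $\delta\in(0,1)$, let $m=o(n)$ and $m=\omega(\log(1/\delta)\log^2n)$. Then the stopping policy $\tau$ of the algorithm CDP-OL with horizon $n$, exploration length $m$ and confidence parameter $\delta$ satisfies $$\mathrm{CR}_n(\tau;\theta)\ge(1-\delta)\left(1-O\!\left(\sqrt{\frac{\log(1/\delta)}{m}}\right)-O\!\left(\frac{m}{n\log n}\right)-O\!\left(\frac1{\log n}\right)\right).$$
   Context: $\mathrm{Exp}(\theta)$ is the distribution with $F_\theta(x)=1-\exp(-\theta x)$ for $x\ge0$. Stopping problem: the rewards $X_1,\dots,X_n$ are observed sequentially, with $\theta$ unknown to the policy. A policy is a stopping time $\tau$ adapted to $(X_t)$, with reward $X_\tau$. $\mathrm{OPT}(\theta):=\mathbb E_\theta[\max_{t\in[n]}X_t]$ and $\mathrm{CR}_n(\tau;\theta):=\mathbb E_\theta[X_\tau]/\mathrm{OPT}(\theta)$. Algorithm CDP-OL for exponential rewards (horizon $n$, exploration length $m<n$, confidence parameter $\delta$): reject $X_1,\dots,X_m$. Put $\widehat\theta_m=m/\sum_{i=1}^mX_i$, $\varepsilon_m=\sqrt{4\log(2/\delta)/m}$, $\theta^{(\mathrm U)}=(1+\varepsilon_m)\widehat\theta_m$, $N=n-m$. Compute $\widehat V_N=1/\theta^{(\mathrm U)}$ and $\widehat V_i=\widehat V_{i+1}+\exp(-\theta^{(\mathrm U)}\widehat V_{i+1})/\theta^{(\mathrm U)}$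 for $i=N-1,\dots,1$. Then $\tau=m+t$ for the smallest $t\in\{1,\dots,N-1\}$ with $X_{m+t}\ge\widehat V_{t+1}$, and $\tau=n$ if no such $t$ exists. Asymptotic notation is as $n\to\infty$. *)

theory Defs
  imports "HOL-Probability.Probability" "HOL-Library.Landau_Symbols"
begin

definition iid_exponential ::
    "'a measure \<Rightarrow> (nat \<Rightarrow> 'a \<Rightarrow> real) \<Rightarrow> nat \<Rightarrow> real \<Rightarrow> bool" where
  "iid_exponential M X n \<theta> \<longleftrightarrow>
     prob_space M \<and>
     prob_space.indep_vars M (\<lambda>_. borel) X {1..n} \<and>
     (\<forall>i\<in>{1..n}. distributed M lborel (X i) (exponential_density \<theta>))"

definition OPT :: "'a measure \<Rightarrow> (nat \<Rightarrow> 'a \<Rightarrow> real) \<Rightarrow> nat \<Rightarrow> real" where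
  "OPT M X n = (\<integral>\<omega>. Max ((\<lambda>t. X t \<omega>) ` {1..n}) \<partial>M)"

definition competitive_ratio ::
    "'a measure \<Rightarrow> (nat \<Rightarrow> 'a \<Rightarrow> real) \<Rightarrow> nat \<Rightarrow> ('a \<Rightarrow> nat) \<Rightarrow> real" where
  "competitive_ratio M X n \<tau> = (\<integral>\<omega>. X (\<tau> \<omega>) \<omega> \<partial>M) / OPT M X n"

text \<open>The algorithm is defined on a path \<open>x\<close> of observed rewards, with \<open>x t\<close> the reward at
  time \<open>t \<in> {1..n}\<close>.\<close>

definition rate_estimate :: "nat \<Rightarrow> (nat \<Rightarrow> real) \<Rightarrow> real" where
  "rate_estimate m x = real m / (\<Sum>i=1..m. x i)"

definition conf_radius :: "nat \<Rightarrow> real \<Rightarrow> real" where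
  "conf_radius m \<delta> = sqrt (4 * ln (2 / \<delta>) / real m)"

definition rate_upper :: "nat \<Rightarrow> real \<Rightarrow> (nat \<Rightarrow> real) \<Rightarrow> real" where
  "rate_upper m \<delta> x = (1 + conf_radius m \<delta>) * rate_estimate m x"

text \<open>The backward recursion is indexed by the number of steps after the current one: with
  exploitation horizon \<open>N\<close>, the value at exploitation step \<open>i\<close> is \<open>plug_in_value r (N - i)\<close>,
  and the last step has value \<open>plug_in_value r 0\<close>.\<close>

fun plug_in_value :: "real \<Rightarrow> nat \<Rightarrow> real" where
  "plug_in_value r 0 = 1 / r"
| "plug_in_value r (Suc k) = plug_in_value r k + exp (- r * plug_in_value r k) / r"

definition value_estimate :: "nat \<Rightarrow> nat \<Rightarrow> real \<Rightarrow> (nat \<Rightarrow> real) \<Rightarrow> nat \<Rightarrow> real" where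
  "value_estimate n m \<delta> x i = plug_in_value (rate_upper m \<delta> x) ((n - m) - i)"

definition cdp_ol :: "nat \<Rightarrow> nat \<Rightarrow> real \<Rightarrow> (nat \<Rightarrow> real) \<Rightarrow> nat" where
  "cdp_ol n m \<delta> x =
     (let T = {t \<in> {1..n - m - 1}. x (m + t) \<ge> value_estimate n m \<delta> x (t + 1)}
      in if T = {} then n else m + Min T)"

end

theory Submission
  imports Defs
begin

text \<open>Put \<open>N = n - m\<close> and let \<open>r\<close> be the rate used by the policy. Along the exploitation phase the
  reward telescopes into the plug-in value of the first exploitation step plus increments
  \<open>max (X (m + t)) W - V\<close>, with \<open>W\<close> the plug-in continuation value at step \<open>t\<close> and \<open>V\<close> the plug-in
  value of step \<open>t\<close>. If \<open>\<theta> \<le> r\<close>, these increments have nonnegative mean given the past, so on that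
  event the policy earns on average at least its own plug-in value, which is at least \<open>ln N / r\<close>.
  A Chernoff bound gives \<open>\<theta> \<le> r \<le> (1 + \<epsilon>) / (1 - \<epsilon>) * \<theta>\<close> with probability at least \<open>1 - \<delta>\<close>,
  and \<open>OPT \<le> (ln n + 1) / \<theta>\<close>.\<close>

section \<open>Moments, tails and maxima of exponential variables\<close>

lemma integral_exponential_density:
  assumes "0 < l"
  shows "integrable lborel (exponential_density l)" "integral\<^sup>L lborel (exponential_density l) = 1"
proof -
  interpret N: prob_space "density lborel (exponential_density l)"
    using assms by (rule prob_space_exponential_density)
  have nonneg: "AE x in lborel. 0 \<le> exponential_density l x"
    using assms by (simp add: exponential_density_nonneg)
  have "integrable (density lborel (exponential_density l)) (\<lambda>_. 1::real)"
    by simp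
  then show "integrable lborel (exponential_density l)"
    by (subst (asm) integrable_real_density) (use nonneg in auto)
  have "(\<integral>x. 1 \<partial>density lborel (exponential_density l)) = (1::real)"
    using N.prob_space by simp
  then show "integral\<^sup>L lborel (exponential_density l) = 1"
    by (subst (asm) integral_real_density) (use nonneg in auto)
qed

context prob_space
begin

text \<open>Exponential tilting: the density of rate \<open>l\<close> times
  \<open>exp (s * x)\<close> is a multiple of the density of rate \<open>l - s\<close>, whose total
  mass is 1.\<close>

lemma exponential_distributed_mgf:
  assumes D: "distributed M lborel X (exponential_density l)" and l: "0 < l" and s: "s < l"
  shows "integrable M (\<lambda>\<omega>. exp (s * X \<omega>))" "expectation (\<lambda>\<omega>. exp (s * X \<omega>)) = l / (l - s)"
proof -
  have eq: "exponential_density l x * exp (s * x) = l / (l - s) * exponential_density (l - s) x" for x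
  proof -
    have "exp (- x * l) * exp (s * x) = exp (- x * (l - s))"
      by (simp add: exp_add[symmetric] algebra_simps)
    then show ?thesis
      using l s by (simp add: exponential_density_def)
  qed
  have nonneg: "0 \<le> exponential_density l x" for x
    using l by (rule exponential_density_nonneg)
  have "integrable lborel (\<lambda>x. exponential_density l x * exp (s * x))"
    unfolding eq using s by (intro integrable_mult_right integral_exponential_density) auto
  then show "integrable M (\<lambda>\<omega>. exp (s * X \<omega>))"
    by (subst (asm) distributed_integrable[OF D]) (use nonneg in auto)
  have "expectation (\<lambda>\<omega>. exp (s * X \<omega>)) = (\<integral>x. exponential_density l x * exp (s * x) \<partial>lborel)"
    by (rule distributed_integral[OF D, symmetric]) (use nonneg in auto)
  also have "\<dots> = l / (l - s)"
    unfolding eq using s by (simp add: integral_exponential_density)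
  finally show "expectation (\<lambda>\<omega>. exp (s * X \<omega>)) = l / (l - s)" .
qed

lemma exponential_distributed_integrable:
  assumes "distributed M lborel X (exponential_density l)" and "0 < l"
  shows "integrable M X"
  using erlang_ith_moment_integrable[OF assms(2,1), of 1] by simp

text \<open>Memorylessness: shifting the variable by \<open>v\<close> turns the excess integral into
  \<open>exp (- l * v)\<close> times the mean.\<close>

lemma exponential_distributed_excess:
  assumes D: "distributed M lborel X (exponential_density l)" and l: "0 < l" and v: "0 \<le> v"
  shows "integrable M (\<lambda>\<omega>. max (X \<omega> - v) 0)"
    and "expectation (\<lambda>\<omega>. max (X \<omega> - v) 0) = exp (- l * v) / l"
proof -
  have nonneg: "0 \<le> exponential_density l x" for x
    using l by (rule exponential_density_nonneg)
  have int: "integrable M X"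
    using D l by (rule exponential_distributed_integrable)
  then show "integrable M (\<lambda>\<omega>. max (X \<omega> - v) 0)"
    by (intro integrable_max integrable_diff) auto
  \<comment> \<open>The spelling \<open>v + 1 * x\<close> is the one produced by
    \<open>lborel_integral_real_affine\<close> with \<open>c = 1\<close>. For negative
    \<open>x\<close> both sides vanish.\<close>
  have eq: "exponential_density l (v + 1 * x) * max (v + 1 * x - v) 0
      = exp (- l * v) * (exponential_density l x * x)" for x
  proof -
    have "exp (- (v + x) * l) = exp (- l * v) * exp (- x * l)"
      by (simp add: exp_add[symmetric] algebra_simps)
    then show ?thesis
      using v by (auto simp: exponential_density_def max_def)
  qed
  have "expectation (\<lambda>\<omega>. max (X \<omega> - v) 0)
      = (\<integral>x. exponential_density l x * max (x - v) 0 \<partial>lborel)"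
    by (rule distributed_integral[OF D, symmetric]) (use nonneg in auto)
  also have "\<dots> = exp (- l * v) * (\<integral>x. exponential_density l x * x \<partial>lborel)"
    by (subst lborel_integral_real_affine[where c = 1 and t = v]) (simp_all only: eq, simp)
  also have "(\<integral>x. exponential_density l x * x \<partial>lborel) = expectation X"
    by (rule distributed_integral[OF D]) (use nonneg in auto)
  also have "expectation X = 1 / l"
    using l D by (rule exponential_distributed_expectation)
  finally show "expectation (\<lambda>\<omega>. max (X \<omega> - v) 0) = exp (- l * v) / l"
    by simp
qed

lemma exponential_distributed_max:
  assumes D: "distributed M lborel X (exponential_density l)" and l: "0 < l" and v: "0 \<le> v"
  shows "expectation (\<lambda>\<omega>. max (X \<omega>) v) = v + exp (- l * v) / l"
proof -
  have "expectation (\<lambda>\<omega>. max (X \<omega>) v) = expectation (\<lambda>\<omega>. v + max (X \<omega> - v) 0)"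
    by (intro Bochner_Integration.integral_cong) auto
  also have "\<dots> = v + exp (- l * v) / l"
    using exponential_distributed_excess[OF assms] by (simp add: prob_space)
  finally show ?thesis .
qed

lemma exponential_distributed_AE_nonneg:
  assumes D: "distributed M lborel X (exponential_density l)" and l: "0 < l"
  shows "AE \<omega> in M. 0 \<le> X \<omega>"
  by (subst distributed_AE2[where P = "\<lambda>x. 0 \<le> x", OF D]) (auto simp: exponential_density_def)

text \<open>The Chernoff parameter is \<open>l (1 - 1 / x)\<close>, for which the moment generating function of
  every summand takes the value \<open>x\<close>.\<close>

lemma
  assumes I: "finite I" and indep: "indep_vars (\<lambda>_. borel) X I"
    and D: "\<And>i. i \<in> I \<Longrightarrow> distributed M lborel (X i) (exponential_density l)"
    and l: "0 < l" and x: "0 < x"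
  shows exponential_sum_upper_tail: "1 < x \<Longrightarrow>
      prob {\<omega>\<in>space M. (\<Sum>i\<in>I. X i \<omega>) \<ge> real (card I) * x / l} \<le> (x * exp (1 - x)) ^ card I"
    and exponential_sum_lower_tail: "x < 1 \<Longrightarrow>
      prob {\<omega>\<in>space M. (\<Sum>i\<in>I. X i \<omega>) \<le> real (card I) * x / l} \<le> (x * exp (1 - x)) ^ card I"
proof -
  let ?S = "\<lambda>\<omega>. \<Sum>i\<in>I. X i \<omega>"
  define s where "s = l * (1 - 1 / x)"
  have s: "s < l" "l / (l - s) = x" "s * (real (card I) * x / l) = real (card I) * (x - 1)"
    using l x by (auto simp: s_def field_simps)
  have indep': "indep_vars (\<lambda>_. borel) (\<lambda>i \<omega>. exp (s * X i \<omega>)) I"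
    by (rule indep_vars_compose2[OF indep]) auto
  have int: "integrable M (\<lambda>\<omega>. exp (s * X i \<omega>))" if "i \<in> I" for i
    using exponential_distributed_mgf(1)[OF D[OF that] l s(1)] .
  have prod: "exp (s * ?S \<omega>) = (\<Prod>i\<in>I. exp (s * X i \<omega>))" for \<omega>
    using I by (simp add: sum_distrib_left exp_sum)
  have int_S: "integrable M (\<lambda>\<omega>. exp (s * ?S \<omega>))"
    unfolding prod by (rule indep_vars_integrable[OF I indep' int])
  have "expectation (\<lambda>\<omega>. exp (s * ?S \<omega>)) = (\<Prod>i\<in>I. expectation (\<lambda>\<omega>. exp (s * X i \<omega>)))"
    unfolding prod by (rule indep_vars_lebesgue_integral[OF I indep' int])
  also have "\<dots> = (\<Prod>i\<in>I. x)"
    using s exponential_distributed_mgf(2)[OF D l s(1)] by (intro prod.cong) auto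
  finally have mgf: "expectation (\<lambda>\<omega>. exp (s * ?S \<omega>)) = x ^ card I"
    by simp
  have bound: "exp (- (real (card I) * (x - 1))) * x ^ card I = (x * exp (1 - x)) ^ card I"
    by (simp add: power_mult_distrib exp_of_nat_mult[symmetric] algebra_simps)
  \<comment> \<open>The Chernoff inequalities speak of set integrals over an event, taken here to be
    the whole space.\<close>
  have set_int: "set_integrable M (space M) (\<lambda>\<omega>. exp (s * ?S \<omega>))"
    unfolding set_integrable_def
    by (subst Bochner_Integration.integrable_cong[OF refl]) (use int_S in auto)
  have set_mgf: "(\<integral>\<omega>\<in>space M. exp (s * ?S \<omega>) \<partial>M) = x ^ card I"
    unfolding mgf[symmetric] by (rule set_integral_space[OF int_S])
  show "prob {\<omega>\<in>space M. ?S \<omega> \<ge> real (card I) * x / l} \<le> (x * exp (1 - x)) ^ card I" if "1 < x"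
  proof -
    have "0 < s"
      using that l by (simp add: s_def)
    from Chernoff_ineq_ge[OF this set_int, of "real (card I) * x / l"] show ?thesis
      by (simp only: set_mgf s(3) bound[symmetric] mult_minus_left minus_minus sets.top)
  qed
  show "prob {\<omega>\<in>space M. ?S \<omega> \<le> real (card I) * x / l} \<le> (x * exp (1 - x)) ^ card I" if "x < 1"
  proof -
    \<comment> \<open>For \<open>x < 1\<close> the parameter \<open>s\<close> is negative, so the
      lower-tail inequality is applied with \<open>- s\<close>.\<close>
    have "0 < - s"
      using that l x by (simp add: s_def mult_pos_neg)
    from Chernoff_ineq_le[OF this, of "space M" ?S "real (card I) * x / l"] set_int show ?thesis
      by (simp only: set_mgf s(3) bound[symmetric] mult_minus_left minus_minus sets.top)
  qed
qed

text \<open>A maximum is at most any level \<open>c\<close> plus the sum of the excesses over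
  \<open>c\<close>, and at least each single variable, whose mean is \<open>1 / l\<close>. This
  bounds \<open>OPT\<close> and allows division by it.\<close>

lemma exponential_Max_bounds:
  assumes I: "finite I" "I \<noteq> {}"
    and D: "\<And>i. i \<in> I \<Longrightarrow> distributed M lborel (X i) (exponential_density l)" and l: "0 < l"
  shows "expectation (\<lambda>\<omega>. Max ((\<lambda>i. X i \<omega>) ` I)) \<le> (ln (real (card I)) + 1) / l"
    and "0 < expectation (\<lambda>\<omega>. Max ((\<lambda>i. X i \<omega>) ` I))"
proof -
  \<comment> \<open>At this level each excess has mean \<open>1 / (card I * l)\<close>, so together
    they contribute \<open>1 / l\<close>.\<close>
  define c where "c = ln (real (card I)) / l"
  let ?U = "\<lambda>\<omega>. c + (\<Sum>i\<in>I. max (X i \<omega> - c) 0)"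
  have card: "0 < card I"
    using I by (simp add: card_gt_0_iff)
  have c: "0 \<le> c"
    using card l by (auto simp: c_def)
  have int: "integrable M (X i)" if "i \<in> I" for i
    using D[OF that] l by (rule exponential_distributed_integrable)
  note [measurable] = borel_measurable_integrable[OF int]
  have int_U: "integrable M ?U"
    using exponential_distributed_excess(1)[OF D l c] by auto
  have upper: "Max ((\<lambda>i. X i \<omega>) ` I) \<le> ?U \<omega>" for \<omega>
  proof -
    have "X i \<omega> \<le> ?U \<omega>" if "i \<in> I" for i
      using member_le_sum[of i I "\<lambda>i. max (X i \<omega> - c) 0"] that I by auto
    then show ?thesis
      using I by auto
  qed
  have lower: "X i \<omega> \<le> Max ((\<lambda>i. X i \<omega>) ` I)" if "i \<in> I" for i \<omega>
    using that I by auto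
  obtain i where i: "i \<in> I"
    using I by auto
  have int_Max: "integrable M (\<lambda>\<omega>. Max ((\<lambda>i. X i \<omega>) ` I))"
  proof (rule Bochner_Integration.integrable_bound)
    show "integrable M (\<lambda>\<omega>. \<bar>?U \<omega>\<bar> + \<bar>X i \<omega>\<bar>)"
      by (rule Bochner_Integration.integrable_add[OF integrable_abs[OF int_U] integrable_abs[OF int[OF i]]])
    show "(\<lambda>\<omega>. Max ((\<lambda>i. X i \<omega>) ` I)) \<in> borel_measurable M"
      using I(1) by (intro borel_measurable_Max) (auto simp: borel_measurable_integrable[OF int])
    show "AE \<omega> in M. norm (Max ((\<lambda>i. X i \<omega>) ` I)) \<le> norm (\<bar>?U \<omega>\<bar> + \<bar>X i \<omega>\<bar>)"
      using upper lower[OF i] by (intro AE_I2) (smt (verit) real_norm_def)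
  qed
  have "expectation (\<lambda>\<omega>. Max ((\<lambda>i. X i \<omega>) ` I)) \<le> expectation ?U"
    using int_Max int_U upper by (intro integral_mono)
  also have "\<dots> = c + real (card I) * (exp (- l * c) / l)"
    using exponential_distributed_excess[OF D l c] by (simp add: prob_space)
  also have "exp (- l * c) = 1 / real (card I)"
    using l card by (simp add: c_def exp_minus inverse_eq_divide)
  also have "c + real (card I) * (1 / real (card I) / l) = (ln (real (card I)) + 1) / l"
    using card by (simp add: c_def add_divide_distrib)
  finally show "expectation (\<lambda>\<omega>. Max ((\<lambda>i. X i \<omega>) ` I)) \<le> (ln (real (card I)) + 1) / l" .
  have "0 < 1 / l"
    using l by simp
  also have "1 / l = expectation (X i)"
    using exponential_distributed_expectation[OF l D[OF i]] ..
  also have "\<dots> \<le> expectation (\<lambda>\<omega>. Max ((\<lambda>i. X i \<omega>) ` I))"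
    using int[OF i] int_Max lower[OF i] by (intro integral_mono)
  finally show "0 < expectation (\<lambda>\<omega>. Max ((\<lambda>i. X i \<omega>) ` I))" .
qed

text \<open>Independence makes the joint law a product measure, so by Fubini the past
  \<open>P\<close> can be frozen at a value \<open>p\<close>. This takes the place of conditioning
  on the past.\<close>

lemma indep_var_integral_nonneg:
  fixes g :: "_ \<Rightarrow> real"
  assumes indep: "indep_var S P T Y"
    and g: "g \<in> borel_measurable (S \<Otimes>\<^sub>M T)"
    and int: "integrable M (\<lambda>\<omega>. g (P \<omega>, Y \<omega>))"
    and nonneg: "\<And>p. p \<in> space S \<Longrightarrow> 0 \<le> expectation (\<lambda>\<omega>. g (p, Y \<omega>))"
  shows "0 \<le> expectation (\<lambda>\<omega>. g (P \<omega>, Y \<omega>))"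
proof -
  have PY[measurable]: "random_variable S P" "random_variable T Y"
    and eq: "distr M S P \<Otimes>\<^sub>M distr M T Y = distr M (S \<Otimes>\<^sub>M T) (\<lambda>\<omega>. (P \<omega>, Y \<omega>))"
    using indep by (auto simp: indep_var_distribution_eq)
  note [measurable] = g
  interpret P: prob_space "distr M S P" by (rule prob_space_distr) simp
  interpret Y: prob_space "distr M T Y" by (rule prob_space_distr) simp
  interpret PY: pair_sigma_finite "distr M S P" "distr M T Y" ..
  have int': "integrable (distr M S P \<Otimes>\<^sub>M distr M T Y) g"
    unfolding eq by (subst integrable_distr_eq) (auto intro: int)
  have "expectation (\<lambda>\<omega>. g (P \<omega>, Y \<omega>)) = integral\<^sup>L (distr M S P \<Otimes>\<^sub>M distr M T Y) g"
    unfolding eq by (subst integral_distr) auto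
  also have "\<dots> = (\<integral>p. (\<integral>y. g (p, y) \<partial>distr M T Y) \<partial>distr M S P)"
    by (rule PY.integral_fst'[OF int', symmetric])
  also have "\<dots> = (\<integral>p. expectation (\<lambda>\<omega>. g (p, Y \<omega>)) \<partial>distr M S P)"
  proof (intro Bochner_Integration.integral_cong refl)
    fix p assume "p \<in> space (distr M S P)"
    then have "p \<in> space S" by simp
    then show "(\<integral>y. g (p, y) \<partial>distr M T Y) = expectation (\<lambda>\<omega>. g (p, Y \<omega>))"
      by (subst integral_distr) auto
  qed
  also have "0 \<le> \<dots>"
    using nonneg by (rule Bochner_Integration.integral_nonneg) simp
  finally show ?thesis .
qed

end

section \<open>Plug-in values of the backward recursion\<close>

text \<open>Each recursion step adds at most \<open>1 / r\<close> to the value and at least 1 to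
  \<open>exp (r * plug_in_value r k)\<close>. The logarithmic lower bound yields the reward
  guarantee; the crude upper bound serves integrability.\<close>

lemma plug_in_value_bounds:
  assumes "0 < r"
  shows "plug_in_value r k \<le> real (Suc k) / r" and "ln (real (Suc k)) \<le> r * plug_in_value r k"
    and "0 < plug_in_value r k"
proof -
  show pos: "0 < plug_in_value r k" for k
    using assms by (induction k) (auto simp: add_pos_pos)
  show "plug_in_value r k \<le> real (Suc k) / r"
  proof (induction k)
    case (Suc k)
    have "exp (- r * plug_in_value r k) / r \<le> 1 / r"
      using assms pos[of k] by (intro divide_right_mono) auto
    with Suc show ?case
      by (simp add: add_divide_distrib)
  qed simp
  have "real (Suc k) \<le> exp (r * plug_in_value r k)"
  proof (induction k)
    case 0
    then show ?case using assms by simp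
  next
    case (Suc k)
    let ?a = "r * plug_in_value r k"
    have "real (Suc (Suc k)) \<le> exp ?a + 1"
      using Suc by simp
    also have "\<dots> = exp ?a * (1 + exp (- ?a))"
      by (simp add: distrib_left exp_minus)
    \<comment> \<open>This is \<open>1 + u \<le> exp u\<close> at \<open>u = exp (- ?a)\<close>,
      which is \<open>r\<close> times the increment of the recursion.\<close>
    also have "\<dots> \<le> exp ?a * exp (exp (- ?a))"
      by (intro mult_left_mono) (auto simp: exp_ge_add_one_self)
    also have "\<dots> = exp (r * plug_in_value r (Suc k))"
      using assms by (simp add: exp_add[symmetric] algebra_simps)
    finally show ?case .
  qed
  then show "ln (real (Suc k)) \<le> r * plug_in_value r k"
    by (metis ln_exp ln_le_cancel_iff exp_gt_zero of_nat_0_less_iff zero_less_Suc)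
qed

text \<open>The value of rejecting at exploitation step \<open>t\<close>; it is \<open>0\<close> at the last step, where the
  policy has to accept.\<close>

definition continuation_value :: "nat \<Rightarrow> real \<Rightarrow> nat \<Rightarrow> real" where
  "continuation_value N r t = (if t < N then plug_in_value r (N - Suc t) else 0)"

lemma continuation_value_bounds:
  assumes "0 < r"
  shows "0 \<le> continuation_value N r t" and "continuation_value N r t \<le> real N / r"
proof -
  show "0 \<le> continuation_value N r t"
    using plug_in_value_bounds(3)[OF assms, of "N - Suc t"] by (auto simp: continuation_value_def)
  show "continuation_value N r t \<le> real N / r"
  proof (cases "t < N")
    case True
    then have "continuation_value N r t \<le> real (Suc (N - Suc t)) / r"
      using plug_in_value_bounds(1)[OF assms] by (simp only: continuation_value_def if_True)
    also have "\<dots> \<le> real N / r"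
      using assms True by (intro divide_right_mono) auto
    finally show ?thesis .
  qed (use assms in \<open>simp add: continuation_value_def\<close>)
qed

text \<open>For \<open>t < N\<close> this is the recursion itself; at \<open>t = N\<close> the
  continuation value 0 gives \<open>1 / r\<close>, the value of the last step. One formula thus
  covers every exploitation step.\<close>

lemma plug_in_value_continuation:
  assumes "t \<le> N"
  shows "plug_in_value r (N - t)
    = continuation_value N r t + exp (- r * continuation_value N r t) / r"
proof (cases "t < N")
  case True
  then have "N - t = Suc (N - Suc t)" by simp
  then show ?thesis using True by (simp add: continuation_value_def)
qed (use assms in \<open>simp add: continuation_value_def\<close>)

lemma measurable_plug_in_value[measurable]: "(\<lambda>r. plug_in_value r k) \<in> borel_measurable borel"
  by (induction k) simp_all

lemma measurable_continuation_value[measurable]: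
  "(\<lambda>r. continuation_value N r t) \<in> borel_measurable borel"
  unfolding continuation_value_def by simp

section \<open>The policy as a first hitting time, and its telescoped reward\<close>

text \<open>A least index is the form to which \<open>measurable_Least\<close> applies. The disjunct
  \<open>j = n\<close> absorbs the case of an empty acceptance set and ensures that a least index
  exists.\<close>

lemma cdp_ol_eq_Least:
  assumes "m < n"
  shows "cdp_ol n m \<delta> x = (LEAST j. j = n \<or>
    m < j \<and> j < n \<and> continuation_value (n - m) (rate_upper m \<delta> x) (j - m) \<le> x j)"
    (is "_ = (LEAST j. ?P j)")
proof -
  define T where "T = {t \<in> {1..n - m - 1}. x (m + t) \<ge> value_estimate n m \<delta> x (t + 1)}"
  have T: "t \<in> T \<longleftrightarrow> 0 < t \<and> t < n - m \<and>
      continuation_value (n - m) (rate_upper m \<delta> x) t \<le> x (m + t)" for t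
    by (auto simp: T_def value_estimate_def continuation_value_def)
  have P: "j = n \<or> j - m \<in> T \<and> m < j" if "?P j" for j
    using that by (auto simp: T)
  have cdp: "cdp_ol n m \<delta> x = (if T = {} then n else m + Min T)"
    unfolding cdp_ol_def T_def Let_def by (rule refl)
  have fin: "finite T"
    by (simp add: T_def)
  show ?thesis
  proof (cases "T = {}")
    case True
    then have "(LEAST j. ?P j) = n"
      using P by (intro Least_equality) fastforce+
    then show ?thesis
      using True by (simp add: cdp)
  next
    case False
    then have "Min T \<in> T"
      using fin by simp
    have "(LEAST j. ?P j) = m + Min T"
    proof (rule Least_equality)
      show "?P (m + Min T)"
        using \<open>Min T \<in> T\<close> by (auto simp: T)
      fix j assume "?P j"
      then consider "j = n" | "j - m \<in> T" "m < j"
        using P by blast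
      then show "m + Min T \<le> j"
      proof cases
        case 1
        then show ?thesis using \<open>Min T \<in> T\<close> by (auto simp: T)
      next
        case 2
        then show ?thesis using Min_le[OF fin 2(1)] by simp
      qed
    qed
    then show ?thesis
      using False by (simp add: cdp)
  qed
qed

text \<open>Minimality of the stopping index, rewritten in exploitation steps. For
  \<open>k = n - m\<close> no acceptance inequality is available, since the policy then stops by
  default.\<close>

lemma cdp_ol_stopping:
  assumes "m < n"
  obtains k where "cdp_ol n m \<delta> x = m + k" "1 \<le> k" "k \<le> n - m"
    "\<And>s. s \<in> {1..<k} \<Longrightarrow> x (m + s) < continuation_value (n - m) (rate_upper m \<delta> x) s"
    "k < n - m \<Longrightarrow> continuation_value (n - m) (rate_upper m \<delta> x) k \<le> x (m + k)"
proof -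
  let ?P = "\<lambda>j. j = n \<or>
    m < j \<and> j < n \<and> continuation_value (n - m) (rate_upper m \<delta> x) (j - m) \<le> x j"
  define j where "j = cdp_ol n m \<delta> x"
  have j: "j = (LEAST j. ?P j)"
    unfolding j_def by (rule cdp_ol_eq_Least[OF assms])
  have Pj: "?P j"
    unfolding j by (rule LeastI[of ?P n]) simp
  have less: "\<not> ?P i" if "i < j" for i
    using that unfolding j by (rule not_less_Least)
  show ?thesis
  proof (rule that[of "j - m"])
    show "cdp_ol n m \<delta> x = m + (j - m)" "1 \<le> j - m" "j - m \<le> n - m"
      using Pj assms by (auto simp: j_def[symmetric])
    show "continuation_value (n - m) (rate_upper m \<delta> x) (j - m) \<le> x (m + (j - m))"
      if "j - m < n - m"
      using Pj that assms by auto
    fix s assume s: "s \<in> {1..<j - m}"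
    then have "\<not> ?P (m + s)"
      by (intro less) auto
    then show "x (m + s) < continuation_value (n - m) (rate_upper m \<delta> x) s"
      using s Pj assms by auto
  qed
qed

text \<open>Before \<open>k\<close> the maximum equals \<open>W t = V (Suc t)\<close>, so the
  increments telescope to \<open>V k - V 1\<close>; at \<open>k\<close> the increment is
  \<open>y k - V k\<close>; after \<open>k\<close> the condition fails at
  \<open>s = k\<close>.\<close>

lemma stopped_value_telescope:
  fixes y V W :: "nat \<Rightarrow> real"
  assumes k: "1 \<le> k" "k \<le> N" and before: "\<And>s. s \<in> {1..<k} \<Longrightarrow> y s < W s" and stop: "W k \<le> y k"
    and W: "\<And>s. s \<in> {1..<k} \<Longrightarrow> W s = V (Suc s)"
  shows "y k = V 1 + (\<Sum>t=1..N. if \<forall>s\<in>{1..<t}. y s < W s then max (y t) (W t) - V t else 0)"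
proof -
  let ?f = "\<lambda>t. if \<forall>s\<in>{1..<t}. y s < W s then max (y t) (W t) - V t else 0"
  have "sum ?f {1..N} = sum ?f {1..k}"
  proof (rule sum.mono_neutral_right)
    show "\<forall>t\<in>{1..N} - {1..k}. ?f t = 0"
    proof
      fix t assume "t \<in> {1..N} - {1..k}"
      then have "k \<in> {1..<t}"
        using k by auto
      with stop have "\<not> (\<forall>s\<in>{1..<t}. y s < W s)"
        by (meson not_le)
      then show "?f t = 0" by (rule if_not_P)
    qed
  qed (use k in auto)
  also have "\<dots> = sum ?f {1..<k} + ?f k"
    using k by (simp add: sum.last_plus add.commute)
  also have "sum ?f {1..<k} = (\<Sum>t\<in>{1..<k}. V (Suc t) - V t)"
  proof (rule sum.cong)
    fix t assume t: "t \<in> {1..<k}"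
    then have "\<forall>s\<in>{1..<t}. y s < W s"
      using before by auto
    then show "?f t = V (Suc t) - V t"
      using before[OF t] W[OF t] by simp
  qed simp
  also have "\<dots> = V k - V 1"
    by (rule sum_Suc_diff'[OF k(1)])
  also have "?f k = y k - V k"
    using before stop by auto
  finally show ?thesis by simp
qed

lemma measurable_rate_upper:
  assumes "\<And>i. i \<in> {1..m} \<Longrightarrow> (\<lambda>\<omega>. f \<omega> i) \<in> borel_measurable M"
  shows "(\<lambda>\<omega>. rate_upper m \<delta> (f \<omega>)) \<in> borel_measurable M"
  unfolding rate_upper_def rate_estimate_def using assms by measurable

lemma rate_upper_cong:
  assumes "\<And>i. i \<in> {1..m} \<Longrightarrow> x i = y i"
  shows "rate_upper m \<delta> x = rate_upper m \<delta> y"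
  using assms by (simp add: rate_upper_def rate_estimate_def)

lemma measurable_cdp_ol:
  assumes "m < n" and X[measurable]: "\<And>i. i \<in> {1..n} \<Longrightarrow> X i \<in> borel_measurable M"
  shows "(\<lambda>\<omega>. cdp_ol n m \<delta> (\<lambda>t. X t \<omega>)) \<in> measurable M (count_space UNIV)"
proof -
  have [measurable]: "(\<lambda>\<omega>. rate_upper m \<delta> (\<lambda>t. X t \<omega>)) \<in> borel_measurable M"
    using assms by (intro measurable_rate_upper) auto
  have P: "Measurable.pred M (\<lambda>\<omega>. j = n \<or> m < j \<and> j < n \<and>
      continuation_value (n - m) (rate_upper m \<delta> (\<lambda>t. X t \<omega>)) (j - m) \<le> X j \<omega>)" for j
  proof (cases "m < j \<and> j < n")
    case True
    then have [measurable]: "X j \<in> borel_measurable M"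
      by (intro X) auto
    show ?thesis by measurable
  next
    case False
    then show ?thesis by auto
  qed
  show ?thesis
    unfolding cdp_ol_eq_Least[OF assms(1)] using P by (rule measurable_Least)
qed

lemma cdp_ol_range: "m < n \<Longrightarrow> cdp_ol n m \<delta> x \<in> {1..n}"
  by (rule cdp_ol_stopping[of m n \<delta> x]) auto

section \<open>Expected reward and competitive ratio of the policy\<close>

lemma iid_exponentialD:
  assumes "iid_exponential M X n \<theta>"
  shows "prob_space M" "prob_space.indep_vars M (\<lambda>_. borel) X {1..n}"
    "i \<in> {1..n} \<Longrightarrow> distributed M lborel (X i) (exponential_density \<theta>)"
  using assms by (auto simp: iid_exponential_def)

text \<open>With \<open>W\<close> the continuation value, \<open>max (X (m + t)) W\<close> has mean \<open>W + exp (- \<theta> * W) / \<theta>\<close>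
  given the past, while \<open>plug_in_value r (N - t) = W + exp (- r * W) / r\<close>: overestimating the
  rate makes every increment of the telescoping sum a submartingale increment.\<close>

lemma cdp_ol_increment_nonneg:
  fixes \<delta> \<kappa> :: real
  assumes iid: "iid_exponential M X n \<theta>" and \<theta>: "0 < \<theta>" and mn: "m < n"
    and t: "t \<in> {1..n - m}"
  defines "r \<equiv> rate_upper m \<delta>" and "N \<equiv> n - m"
  defines "F \<equiv> (\<lambda>x y. if \<theta> \<le> r x \<and> r x \<le> \<kappa> * \<theta> \<and> (\<forall>s\<in>{1..<t}. x (m + s) < continuation_value N (r x) s)
    then max y (continuation_value N (r x) t) - plug_in_value (r x) (N - t) else 0)"
  shows "integrable M (\<lambda>\<omega>. F (\<lambda>i. X i \<omega>) (X (m + t) \<omega>))"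
    and "0 \<le> (\<integral>\<omega>. F (\<lambda>i. X i \<omega>) (X (m + t) \<omega>) \<partial>M)"
proof -
  interpret prob_space M
    using iid by (rule iid_exponentialD)
  define k where "k = m + t"
  have k: "k \<in> {1..n}" "m < k"
    using t by (auto simp: k_def)
  \<comment> \<open>The past and the current reward are both encoded as restricted families, the
    latter over a singleton, to match \<open>indep_var_restrict\<close>.\<close>
  define S where "S = PiM {1..<k} (\<lambda>_. borel :: real measure)"
  define P where "P = (\<lambda>\<omega>. restrict (\<lambda>i. X i \<omega>) {1..<k})"
  define T where "T = PiM {k} (\<lambda>_. borel :: real measure)"
  define Q where "Q = (\<lambda>\<omega>. restrict (\<lambda>i. X i \<omega>) {k})"
  have D: "distributed M lborel (X k) (exponential_density \<theta>)"
    using iid_exponentialD(3)[OF iid k(1)] .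
  have int_Xk: "integrable M (X k)"
    using D \<theta> by (rule exponential_distributed_integrable)
  have indep: "indep_var S P T Q"
    unfolding S_def P_def T_def Q_def using k
    by (intro indep_var_restrict[OF iid_exponentialD(2)[OF iid]]) auto
  have Q: "Q \<omega> k = X k \<omega>" for \<omega>
    by (simp add: Q_def)
  \<comment> \<open>\<open>F\<close> reads the path only at indices below \<open>k\<close>, both
    through the rate and through the rejection conditions.\<close>
  have F_P: "F (\<lambda>i. X i \<omega>) y = F (P \<omega>) y" for \<omega> y
  proof -
    have "r (P \<omega>) = r (\<lambda>i. X i \<omega>)"
      unfolding r_def using k by (intro rate_upper_cong) (auto simp: P_def)
    moreover have "P \<omega> (m + s) = X (m + s) \<omega>" if "s \<in> {1..<t}" for s
      using that by (auto simp: P_def k_def)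
    ultimately show ?thesis
      unfolding F_def by (auto cong: ball_cong)
  qed
  have comp: "(\<lambda>p. fst p i) \<in> borel_measurable (S \<Otimes>\<^sub>M T)" if "i \<in> {1..<k}" for i
    unfolding S_def using that by measurable
  have [measurable]: "(\<lambda>p. r (fst p)) \<in> borel_measurable (S \<Otimes>\<^sub>M T)"
    unfolding r_def using k by (intro measurable_rate_upper comp) auto
  have [measurable]: "(\<lambda>p. fst p (m + s)) \<in> borel_measurable (S \<Otimes>\<^sub>M T)" if "s \<in> {1..<t}" for s
    using that by (intro comp) (auto simp: k_def)
  have [measurable]: "(\<lambda>p. snd p k) \<in> borel_measurable (S \<Otimes>\<^sub>M T)"
    unfolding T_def by measurable
  have meas: "(\<lambda>p. F (fst p) (snd p k)) \<in> borel_measurable (S \<Otimes>\<^sub>M T)"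
    unfolding F_def by measurable
  \<comment> \<open>Where \<open>F\<close> is nonzero, \<open>\<theta> \<le> r x\<close> caps both
    plug-in quantities by constants over \<open>\<theta>\<close>; this gives an integrable
    majorant.\<close>
  have bound: "\<bar>F x y\<bar> \<le> \<bar>y\<bar> + (2 * real N + 1) / \<theta>" for x y
  proof (cases "\<theta> \<le> r x")
    case True
    let ?W = "continuation_value N (r x) t" and ?V = "plug_in_value (r x) (N - t)"
    have r: "0 < r x"
      using True \<theta> by simp
    have le: "c / r x \<le> c / \<theta>" if "0 \<le> c" for c :: real
      using True \<theta> that by (intro divide_left_mono) auto
    have W: "0 \<le> ?W" "?W \<le> real N / \<theta>"
      using continuation_value_bounds[OF r, of N t] le[of "real N"] by auto
    have "?V \<le> real (Suc (N - t)) / \<theta>"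
      using plug_in_value_bounds(1)[OF r, of "N - t"] le[of "real (Suc (N - t))"] by simp
    also have "\<dots> \<le> (real N + 1) / \<theta>"
      using \<theta> by (intro divide_right_mono) auto
    finally have V: "0 < ?V" "?V \<le> (real N + 1) / \<theta>"
      using plug_in_value_bounds(3)[OF r] by auto
    have "(2 * real N + 1) / \<theta> = real N / \<theta> + (real N + 1) / \<theta>"
      by (simp add: add_divide_distrib)
    moreover have "\<bar>max y ?W - ?V\<bar> \<le> \<bar>y\<bar> + real N / \<theta> + (real N + 1) / \<theta>"
      using W V by linarith
    moreover have "0 \<le> \<bar>y\<bar> + real N / \<theta> + (real N + 1) / \<theta>"
      using \<theta> by auto
    ultimately show ?thesis
      unfolding F_def by simp
  next
    case False
    then show ?thesis
      using \<theta> by (simp add: F_def)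
  qed
  have int: "integrable M (\<lambda>\<omega>. F (P \<omega>) (X k \<omega>))"
  proof (rule Bochner_Integration.integrable_bound)
    show "integrable M (\<lambda>\<omega>. \<bar>X k \<omega>\<bar> + (2 * real N + 1) / \<theta>)"
      using int_Xk by simp
    have "(\<lambda>\<omega>. (P \<omega>, Q \<omega>)) \<in> M \<rightarrow>\<^sub>M S \<Otimes>\<^sub>M T"
      using indep_var_rv1[OF indep] indep_var_rv2[OF indep] by measurable
    from measurable_compose[OF this meas]
    show "(\<lambda>\<omega>. F (P \<omega>) (X k \<omega>)) \<in> borel_measurable M"
      by (simp add: Q)
    show "AE \<omega> in M. norm (F (P \<omega>) (X k \<omega>)) \<le> norm (\<bar>X k \<omega>\<bar> + (2 * real N + 1) / \<theta>)"
      using bound by (intro AE_I2) (smt (verit) real_norm_def)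
  qed
  then show "integrable M (\<lambda>\<omega>. F (\<lambda>i. X i \<omega>) (X (m + t) \<omega>))"
    by (simp add: F_P k_def)
  have mean: "0 \<le> expectation (\<lambda>\<omega>. F p (X k \<omega>))" for p
  proof (cases "\<theta> \<le> r p \<and> r p \<le> \<kappa> * \<theta> \<and> (\<forall>s\<in>{1..<t}. p (m + s) < continuation_value N (r p) s)")
    case True
    let ?W = "continuation_value N (r p) t"
    have r: "\<theta> \<le> r p" "0 < r p"
      using True \<theta> by auto
    have W: "0 \<le> ?W"
      using continuation_value_bounds(1)[OF r(2)] .
    have "\<theta> * ?W \<le> r p * ?W"
      using r(1) W by (rule mult_right_mono)
    then have "exp (- r p * ?W) \<le> exp (- \<theta> * ?W)"
      by simp
    then have "exp (- r p * ?W) / r p \<le> exp (- \<theta> * ?W) / \<theta>"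
      using \<theta> r(1) by (rule frac_le[OF exp_ge_zero])
    then have "0 \<le> (?W + exp (- \<theta> * ?W) / \<theta>) - plug_in_value (r p) (N - t)"
      using t by (subst plug_in_value_continuation) (auto simp: N_def)
    also have "\<dots> = expectation (\<lambda>\<omega>. max (X k \<omega>) ?W) - plug_in_value (r p) (N - t)"
      using exponential_distributed_max[OF D \<theta> W] by simp
    also have "\<dots> = expectation (\<lambda>\<omega>. F p (X k \<omega>))"
      using True int_Xk by (simp add: F_def prob_space)
    finally show ?thesis .
  next
    case False
    then have "F p y = 0" for y
      unfolding F_def by (rule if_not_P)
    then show ?thesis by simp
  qed
  have "0 \<le> expectation (\<lambda>\<omega>. F (fst (P \<omega>, Q \<omega>)) (snd (P \<omega>, Q \<omega>) k))"
    by (rule indep_var_integral_nonneg[OF indep, where g = "\<lambda>p. F (fst p) (snd p k)"])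
      (use meas int mean in \<open>auto simp: Q\<close>)
  then show "0 \<le> (\<integral>\<omega>. F (\<lambda>i. X i \<omega>) (X (m + t) \<omega>) \<partial>M)"
    by (simp add: F_P Q flip: k_def)
qed

text \<open>On the event \<open>A\<close> the reward is a plug-in value plus the increments
  \<open>G\<close>; off \<open>A\<close> the increments vanish and the reward is nonnegative almost
  everywhere. The upper limit \<open>\<kappa> * \<theta>\<close> makes the plug-in bound
  deterministic, and the increments sum to a nonnegative mean.\<close>

lemma cdp_ol_expected_reward:
  fixes \<delta> :: real
  assumes iid: "iid_exponential M X n \<theta>" and \<theta>: "0 < \<theta>" and mn: "m < n" and \<kappa>: "0 < \<kappa>"
  defines "r \<equiv> \<lambda>\<omega>. rate_upper m \<delta> (\<lambda>i. X i \<omega>)"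
  shows "measure M {\<omega>\<in>space M. \<theta> \<le> r \<omega> \<and> r \<omega> \<le> \<kappa> * \<theta>} * (ln (real (n - m)) / (\<kappa> * \<theta>))
    \<le> (\<integral>\<omega>. X (cdp_ol n m \<delta> (\<lambda>t. X t \<omega>)) \<omega> \<partial>M)"
proof -
  interpret prob_space M
    using iid by (rule iid_exponentialD)
  note D = iid_exponentialD(3)[OF iid]
  define N where "N = n - m"
  define L where "L = ln (real N) / (\<kappa> * \<theta>)"
  define \<tau> where "\<tau> = (\<lambda>\<omega>. cdp_ol n m \<delta> (\<lambda>t. X t \<omega>))"
  define A where "A = {\<omega>\<in>space M. \<theta> \<le> r \<omega> \<and> r \<omega> \<le> \<kappa> * \<theta>}"
  define G where "G = (\<lambda>t \<omega>. if \<theta> \<le> r \<omega> \<and> r \<omega> \<le> \<kappa> * \<theta> \<and>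
      (\<forall>s\<in>{1..<t}. X (m + s) \<omega> < continuation_value N (r \<omega>) s)
    then max (X (m + t) \<omega>) (continuation_value N (r \<omega>) t) - plug_in_value (r \<omega>) (N - t) else 0)"
  have N: "1 \<le> N"
    using mn by (simp add: N_def)
  have L: "0 \<le> L"
    using N \<kappa> \<theta> by (simp add: L_def)
  have int_X: "integrable M (X i)" if "i \<in> {1..n}" for i
    using D[OF that] \<theta> by (rule exponential_distributed_integrable)
  have meas_X: "X i \<in> borel_measurable M" if "i \<in> {1..n}" for i
    using int_X[OF that] by (rule borel_measurable_integrable)
  have [measurable]: "r \<in> borel_measurable M"
    unfolding r_def using mn by (intro measurable_rate_upper meas_X) auto
  have A[measurable]: "A \<in> sets M"
    unfolding A_def by measurable
  have G: "integrable M (G t)" "0 \<le> expectation (G t)" if "t \<in> {1..N}" for t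
    using cdp_ol_increment_nonneg[OF iid \<theta> mn, of t \<delta> \<kappa>] that
    unfolding G_def r_def N_def by auto
  have range: "\<tau> \<omega> \<in> {1..n}" for \<omega>
    unfolding \<tau>_def using mn by (rule cdp_ol_range)
  have int_reward: "integrable M (\<lambda>\<omega>. X (\<tau> \<omega>) \<omega>)"
  proof (rule Bochner_Integration.integrable_bound)
    show "integrable M (\<lambda>\<omega>. \<Sum>i\<in>{1..n}. \<bar>X i \<omega>\<bar>)"
      using int_X by (intro Bochner_Integration.integrable_sum integrable_abs) auto
    have "\<tau> \<in> M \<rightarrow>\<^sub>M count_space UNIV"
      unfolding \<tau>_def by (rule measurable_cdp_ol[OF mn meas_X])
    \<comment> \<open>Composition with a random index needs \<open>X i\<close> measurable for all
      \<open>i\<close> in the index set, hence the smaller codomain.\<close>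
    then have "\<tau> \<in> M \<rightarrow>\<^sub>M count_space {1..n}"
      by (rule measurable_count_space_extend[OF subset_UNIV Pi_I[OF range]])
    from measurable_compose_countable'[where f = X, OF meas_X this]
    show "(\<lambda>\<omega>. X (\<tau> \<omega>) \<omega>) \<in> borel_measurable M"
      by simp
    show "AE \<omega> in M. norm (X (\<tau> \<omega>) \<omega>) \<le> norm (\<Sum>i\<in>{1..n}. \<bar>X i \<omega>\<bar>)"
    proof (intro AE_I2)
      fix \<omega>
      have "\<bar>X (\<tau> \<omega>) \<omega>\<bar> \<le> (\<Sum>i\<in>{1..n}. \<bar>X i \<omega>\<bar>)"
        by (rule member_le_sum[of "\<tau> \<omega>" "{1..n}" "\<lambda>i. \<bar>X i \<omega>\<bar>"]) (use range in auto)
      then show "norm (X (\<tau> \<omega>) \<omega>) \<le> norm (\<Sum>i\<in>{1..n}. \<bar>X i \<omega>\<bar>)"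
        by simp
    qed
  qed
  have "AE \<omega> in M. \<forall>i\<in>{1..n}. 0 \<le> X i \<omega>"
    using D \<theta> by (intro AE_finite_allI exponential_distributed_AE_nonneg) auto
  then have "AE \<omega> in M. indicator A \<omega> * L + (\<Sum>t=1..N. G t \<omega>) \<le> X (\<tau> \<omega>) \<omega>"
  proof (rule AE_mp, intro AE_I2 impI)
    fix \<omega> assume \<omega>: "\<omega> \<in> space M" and nonneg: "\<forall>i\<in>{1..n}. 0 \<le> X i \<omega>"
    show "indicator A \<omega> * L + (\<Sum>t=1..N. G t \<omega>) \<le> X (\<tau> \<omega>) \<omega>"
    proof (cases "\<omega> \<in> A")
      case True
      then have r: "\<theta> \<le> r \<omega>" "r \<omega> \<le> \<kappa> * \<theta>" "0 < r \<omega>"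
        using \<theta> by (auto simp: A_def)
      obtain k where k: "\<tau> \<omega> = m + k" "1 \<le> k" "k \<le> N"
        and before: "\<And>s. s \<in> {1..<k} \<Longrightarrow> X (m + s) \<omega> < continuation_value N (r \<omega>) s"
        and stop: "k < N \<Longrightarrow> continuation_value N (r \<omega>) k \<le> X (m + k) \<omega>"
        using cdp_ol_stopping[OF mn, of \<delta> "\<lambda>t. X t \<omega>"] unfolding \<tau>_def r_def N_def by blast
      \<comment> \<open>At the last step the continuation value is 0, so nonnegativity of the reward
        replaces the acceptance test.\<close>
      have stop': "continuation_value N (r \<omega>) k \<le> X (m + k) \<omega>"
      proof (cases "k < N")
        case False
        have "m + k \<in> {1..n}"
          using k mn by (auto simp: N_def)
        then show ?thesis
          using False nonneg by (simp add: continuation_value_def)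
      qed (rule stop)
      have W: "continuation_value N (r \<omega>) s = plug_in_value (r \<omega>) (N - Suc s)"
        if "s \<in> {1..<k}" for s
        using that k by (simp add: continuation_value_def)
      have "X (m + k) \<omega> = plug_in_value (r \<omega>) (N - 1) + (\<Sum>t=1..N. G t \<omega>)"
        using stopped_value_telescope[where y = "\<lambda>s. X (m + s) \<omega>" and V = "\<lambda>t. plug_in_value (r \<omega>) (N - t)"
            and W = "continuation_value N (r \<omega>)", OF k(2,3) before stop' W] r
        unfolding G_def by simp
      moreover have "L \<le> plug_in_value (r \<omega>) (N - 1)"
      proof -
        have "ln (real N) \<le> r \<omega> * plug_in_value (r \<omega>) (N - 1)"
          using plug_in_value_bounds(2)[OF r(3), of "N - 1"] N by simp
        also have "\<dots> \<le> \<kappa> * \<theta> * plug_in_value (r \<omega>) (N - 1)"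
          using r plug_in_value_bounds(3)[OF r(3), of "N - 1"] by (intro mult_right_mono) auto
        finally show ?thesis
          using \<kappa> \<theta> by (simp add: L_def divide_le_eq mult.commute)
      qed
      ultimately show ?thesis
        using True k(1) by simp
    next
      case False
      then have "G t \<omega> = 0" for t
        using \<omega> unfolding G_def A_def by auto
      then show ?thesis
        using False nonneg range[of \<omega>] by simp
    qed
  qed
  moreover have int_sum: "integrable M (\<lambda>\<omega>. \<Sum>t=1..N. G t \<omega>)"
    using G(1) by (rule Bochner_Integration.integrable_sum)
  moreover have int_A: "integrable M (\<lambda>\<omega>. indicator A \<omega> * L)"
    using A by (intro integrable_mult_left integrable_real_indicator) (auto simp: emeasure_eq_measure)
  ultimately have le: "expectation (\<lambda>\<omega>. indicator A \<omega> * L + (\<Sum>t=1..N. G t \<omega>))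
      \<le> expectation (\<lambda>\<omega>. X (\<tau> \<omega>) \<omega>)"
    using int_reward by (intro integral_mono_AE Bochner_Integration.integrable_add) auto
  have "prob A * L \<le> prob A * L + (\<Sum>t=1..N. expectation (G t))"
    using sum_nonneg[of "{1..N}" "\<lambda>t. expectation (G t)"] G(2) by auto
  also have "(\<Sum>t=1..N. expectation (G t)) = expectation (\<lambda>\<omega>. \<Sum>t=1..N. G t \<omega>)"
    using G(1) by (rule Bochner_Integration.integral_sum[symmetric])
  also have "prob A * L + \<dots> = expectation (\<lambda>\<omega>. indicator A \<omega> * L + (\<Sum>t=1..N. G t \<omega>))"
    using int_A int_sum A by (simp add: Bochner_Integration.integral_add)
  also note le
  finally show ?thesis
    by (simp add: A_def L_def N_def \<tau>_def)
qed

text \<open>The event is that the sample mean, in units of \<open>1 / \<theta>\<close>, lies between \<open>x\<close> and \<open>1 + \<epsilon>\<close>.\<close>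

lemma prob_rate_upper_ge:
  fixes \<delta> :: real
  assumes iid: "iid_exponential M X n \<theta>" and \<theta>: "0 < \<theta>" and m: "1 \<le> m" "m \<le> n"
    and x: "0 < x" "x < 1" and \<epsilon>: "0 < conf_radius m \<delta>"
  defines "r \<equiv> \<lambda>\<omega>. rate_upper m \<delta> (\<lambda>i. X i \<omega>)" and "\<epsilon> \<equiv> conf_radius m \<delta>"
  shows "1 - ((1 + \<epsilon>) * exp (- \<epsilon>)) ^ m - (x * exp (1 - x)) ^ m
    \<le> measure M {\<omega>\<in>space M. \<theta> \<le> r \<omega> \<and> r \<omega> \<le> (1 + \<epsilon>) / x * \<theta>}"
proof -
  interpret prob_space M
    using iid by (rule iid_exponentialD)
  note D = iid_exponentialD(3)[OF iid]
  have \<epsilon>_pos: "0 < \<epsilon>"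
    using \<epsilon> by (simp add: \<epsilon>_def)
  let ?S = "\<lambda>\<omega>. \<Sum>i=1..m. X i \<omega>"
  define B where "B = {\<omega>\<in>space M. ?S \<omega> \<ge> real (card {1..m}) * (1 + \<epsilon>) / \<theta>}"
  define C where "C = {\<omega>\<in>space M. ?S \<omega> \<le> real (card {1..m}) * x / \<theta>}"
  define A where "A = {\<omega>\<in>space M. \<theta> \<le> r \<omega> \<and> r \<omega> \<le> (1 + \<epsilon>) / x * \<theta>}"
  have D': "distributed M lborel (X i) (exponential_density \<theta>)" if "i \<in> {1..m}" for i
    using that m by (intro D) auto
  have indep: "indep_vars (\<lambda>_. borel) X {1..m}"
    using m by (intro indep_vars_subset[OF iid_exponentialD(2)[OF iid]]) auto
  have meas: "X i \<in> borel_measurable M" if "i \<in> {1..m}" for i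
    using exponential_distributed_integrable[OF D'[OF that] \<theta>] by (rule borel_measurable_integrable)
  have [measurable]: "?S \<in> borel_measurable M"
    using meas by (intro borel_measurable_sum) auto
  have [measurable]: "r \<in> borel_measurable M"
    unfolding r_def by (intro measurable_rate_upper meas) auto
  have sets: "A \<in> events" "B \<in> events" "C \<in> events"
    unfolding A_def B_def C_def by measurable
  have "prob B \<le> ((1 + \<epsilon>) * exp (1 - (1 + \<epsilon>))) ^ card {1..m}"
    unfolding B_def using \<epsilon>_pos by (intro exponential_sum_upper_tail[OF _ indep D' \<theta>]) auto
  then have B: "prob B \<le> ((1 + \<epsilon>) * exp (- \<epsilon>)) ^ m"
    by simp
  have "prob C \<le> (x * exp (1 - x)) ^ card {1..m}"
    unfolding C_def using x by (intro exponential_sum_lower_tail[OF _ indep D' \<theta>]) auto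
  then have C: "prob C \<le> (x * exp (1 - x)) ^ m"
    by simp
  have "space M - A \<subseteq> B \<union> C"
  proof
    fix \<omega> assume \<omega>: "\<omega> \<in> space M - A"
    show "\<omega> \<in> B \<union> C"
    proof (rule ccontr)
      assume "\<omega> \<notin> B \<union> C"
      then have S: "?S \<omega> < real m * (1 + \<epsilon>) / \<theta>" "real m * x / \<theta> < ?S \<omega>"
        using \<omega> by (auto simp: B_def C_def)
      have "0 < real m * x / \<theta>"
        using m x \<theta> by simp
      with S have pos: "0 < ?S \<omega>" by linarith
      have r: "r \<omega> = (1 + \<epsilon>) * real m / ?S \<omega>"
        unfolding r_def rate_upper_def rate_estimate_def \<epsilon>_def by (rule times_divide_eq_right)
      have "\<theta> \<le> r \<omega>"
        unfolding r using S(1) pos \<theta> by (simp add: pos_less_divide_eq pos_le_divide_eq mult_ac)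
      moreover have "r \<omega> \<le> (1 + \<epsilon>) / x * \<theta>"
      proof -
        have "real m \<le> ?S \<omega> * \<theta> / x"
          using S(2) \<theta> x by (simp add: pos_divide_less_eq pos_le_divide_eq)
        then have "(1 + \<epsilon>) * real m \<le> (1 + \<epsilon>) * (?S \<omega> * \<theta> / x)"
          using \<epsilon>_pos by (intro mult_left_mono) auto
        then show ?thesis
          unfolding r using pos x by (simp add: pos_divide_le_eq mult_ac)
      qed
      ultimately show False
        using \<omega> by (simp add: A_def)
    qed
  qed
  then have "prob (space M - A) \<le> prob (B \<union> C)"
    using sets by (intro finite_measure_mono) auto
  also have "\<dots> \<le> prob B + prob C"
    using sets by (intro measure_Un_le)
  finally have "1 - prob A \<le> prob B + prob C"
    using prob_compl[OF sets(1)] by simp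
  then show ?thesis
    using B C by (simp add: A_def)
qed

text \<open>Here \<open>x\<close> is a tuning parameter for the lower tail and \<open>q\<close> a
  lower bound for the probability of the good event. It is used with
  \<open>x = 1 - \<epsilon>\<close> for a small confidence radius \<open>\<epsilon>\<close> and with
  \<open>x = 1 / 20\<close> for \<delta> near 1.\<close>

lemma cdp_ol_competitive_ratio:
  assumes iid: "iid_exponential M X n \<theta>" and \<theta>: "0 < \<theta>" and m: "1 \<le> m" "m < n"
    and x: "0 < x" "x < 1" and \<epsilon>: "0 < conf_radius m \<delta>"
    and q: "0 \<le> q" "q \<le> 1 - ((1 + conf_radius m \<delta>) * exp (- conf_radius m \<delta>)) ^ m - (x * exp (1 - x)) ^ m"
  shows "q * (x / (1 + conf_radius m \<delta>)) * (ln (real (n - m)) / (ln (real n) + 1))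
    \<le> competitive_ratio M X n (\<lambda>\<omega>. cdp_ol n m \<delta> (\<lambda>t. X t \<omega>))"
proof -
  interpret prob_space M
    using iid by (rule iid_exponentialD)
  define \<kappa> where "\<kappa> = (1 + conf_radius m \<delta>) / x"
  have \<kappa>: "0 < \<kappa>"
    using \<epsilon> x by (simp add: \<kappa>_def)
  let ?N = "ln (real (n - m))"
  define R where "R = (\<integral>\<omega>. X (cdp_ol n m \<delta> (\<lambda>t. X t \<omega>)) \<omega> \<partial>M)"
  have N: "0 \<le> ?N"
    using m by simp
  let ?A = "{\<omega>\<in>space M. \<theta> \<le> rate_upper m \<delta> (\<lambda>i. X i \<omega>) \<and> rate_upper m \<delta> (\<lambda>i. X i \<omega>) \<le> \<kappa> * \<theta>}"
  have "q \<le> prob ?A"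
    using q prob_rate_upper_ge[OF iid \<theta> m(1) less_imp_le[OF m(2)] x \<epsilon>] unfolding \<kappa>_def by linarith
  then have "q * (?N / (\<kappa> * \<theta>)) \<le> prob ?A * (?N / (\<kappa> * \<theta>))"
    using N \<kappa> \<theta> by (intro mult_right_mono) auto
  also have "\<dots> \<le> R"
    unfolding R_def by (rule cdp_ol_expected_reward[OF iid \<theta> m(2) \<kappa>])
  finally have R: "q * (?N / (\<kappa> * \<theta>)) \<le> R" .
  have "OPT M X n \<le> (ln (real (card {1..n})) + 1) / \<theta>" "0 < OPT M X n"
    unfolding OPT_def using m
    by (intro exponential_Max_bounds[OF _ _ iid_exponentialD(3)[OF iid] \<theta>]; simp)+
  then have opt: "OPT M X n \<le> (ln (real n) + 1) / \<theta>" "0 < OPT M X n"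
    by simp_all
  \<comment> \<open>The rate \<theta> cancels between the reward and \<open>OPT\<close>, so the
    bound is scale free.\<close>
  have "q * (x / (1 + conf_radius m \<delta>)) * (?N / (ln (real n) + 1))
      = q * (?N / (\<kappa> * \<theta>)) / ((ln (real n) + 1) / \<theta>)"
    using \<theta> x by (simp add: \<kappa>_def)
  also have "\<dots> \<le> q * (?N / (\<kappa> * \<theta>)) / OPT M X n"
    using opt q N \<kappa> \<theta> by (intro divide_left_mono mult_pos_pos) auto
  also have "\<dots> \<le> R / OPT M X n"
    using R opt by (intro divide_right_mono) auto
  finally show ?thesis
    by (simp add: competitive_ratio_def R_def)
qed

section \<open>Logarithmic inequalities behind the tail bounds\<close>

text \<open>Both sides agree at 1, and their difference has derivative
  \<open>(1 - 1 / t)\<^sup>2 / 2\<close>.\<close>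

lemma ln_le_half_diff_inverse:
  fixes x :: real
  assumes "1 \<le> x"
  shows "ln x \<le> (x - 1 / x) / 2"
proof -
  let ?g = "\<lambda>t::real. (t - 1 / t) / 2 - ln t"
  have "?g 1 \<le> ?g x"
  proof (rule DERIV_nonneg_imp_nondecreasing[OF assms])
    fix t :: real assume t: "1 \<le> t" "t \<le> x"
    have "(?g has_real_derivative (1 - 1 / t)\<^sup>2 / 2) (at t)"
      using t by (auto intro!: derivative_eq_intros simp: field_simps power2_eq_square)
    then show "\<exists>y. (?g has_real_derivative y) (at t) \<and> 0 \<le> y"
      by (intro exI[of _ "(1 - 1 / t)\<^sup>2 / 2"]) auto
  qed
  then show ?thesis by simp
qed

text \<open>This gives the upper-tail Chernoff factor a quadratic exponent. The denominator
  \<open>2 * (1 + x)\<close> stays explicit because it is later bounded by 4 or by 8, depending on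
  the range of \<open>x\<close>.\<close>

lemma one_plus_mult_exp_minus_le:
  fixes x :: real
  assumes "0 \<le> x"
  shows "(1 + x) * exp (- x) \<le> exp (- (x\<^sup>2 / (2 * (1 + x))))"
proof -
  have "ln (1 + x) \<le> (1 + x - 1 / (1 + x)) / 2"
    using assms by (intro ln_le_half_diff_inverse) simp
  also have "\<dots> = x - x\<^sup>2 / (2 * (1 + x))"
    using assms by (simp add: field_simps power2_eq_square)
  finally have "exp (ln (1 + x) - x) \<le> exp (- (x\<^sup>2 / (2 * (1 + x))))"
    by simp
  then show ?thesis
    using assms by (simp add: exp_diff exp_minus divide_inverse)
qed

text \<open>The lower-tail counterpart: \<open>?g\<close> vanishes at 0 and has derivative
  \<open>t\<^sup>2 / (1 - t)\<close>.\<close>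

lemma one_minus_mult_exp_le:
  fixes x :: real
  assumes "0 \<le> x" "x < 1"
  shows "(1 - x) * exp x \<le> exp (- (x\<^sup>2 / 2))"
proof -
  let ?g = "\<lambda>t::real. - t - t\<^sup>2 / 2 - ln (1 - t)"
  have "?g 0 \<le> ?g x"
  proof (rule DERIV_nonneg_imp_nondecreasing[OF assms(1)])
    fix t :: real assume t: "0 \<le> t" "t \<le> x"
    have "(?g has_real_derivative t\<^sup>2 / (1 - t)) (at t)"
      using t assms by (auto intro!: derivative_eq_intros simp: field_simps power2_eq_square)
    then show "\<exists>y. (?g has_real_derivative y) (at t) \<and> 0 \<le> y"
      using t assms by (intro exI[of _ "t\<^sup>2 / (1 - t)"]) auto
  qed
  then have "ln (1 - x) + x \<le> - (x\<^sup>2 / 2)"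
    by simp
  then have "exp (ln (1 - x) + x) \<le> exp (- (x\<^sup>2 / 2))"
    by (simp only: exp_le_cancel_iff)
  then show ?thesis
    using assms by (simp add: exp_add)
qed

section \<open>The two regimes of the confidence parameter\<close>

lemma conf_radius_pos_square:
  assumes "0 < \<delta>" "\<delta> < 1" "1 \<le> m"
  shows "0 < conf_radius m \<delta>" and "real m * (conf_radius m \<delta>)\<^sup>2 = 4 * ln (2 / \<delta>)"
proof -
  have "0 < ln (2 / \<delta>)"
    using assms by simp
  then show "0 < conf_radius m \<delta>" "real m * (conf_radius m \<delta>)\<^sup>2 = 4 * ln (2 / \<delta>)"
    using assms by (auto simp: conf_radius_def)
qed

text \<open>For a radius \<epsilon> below 1 and \<open>x = 1 - \<epsilon>\<close>, both tail factors
  are at most \<open>exp (- (\<epsilon>\<^sup>2 / 4))\<close>. The constant 4 in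
  \<open>conf_radius\<close> makes the \<open>m\<close>-th power of this equal to
  \<open>\<delta> / 2\<close>, so the two tails cost \<delta>.\<close>

lemma competitive_ratio_small_conf_radius:
  assumes iid: "iid_exponential M X n \<theta>" and \<theta>: "0 < \<theta>" and m: "1 \<le> m" "m < n"
    and \<delta>: "0 < \<delta>" "\<delta> < 1" and small: "conf_radius m \<delta> < 1"
  shows "(1 - \<delta>) * ((1 - conf_radius m \<delta>) / (1 + conf_radius m \<delta>)) *
      (ln (real (n - m)) / (ln (real n) + 1))
    \<le> competitive_ratio M X n (\<lambda>\<omega>. cdp_ol n m \<delta> (\<lambda>t. X t \<omega>))"
proof -
  let ?\<epsilon> = "conf_radius m \<delta>"
  note \<epsilon> = conf_radius_pos_square[OF \<delta> m(1)]
  have half: "exp (- (?\<epsilon>\<^sup>2 / 4)) ^ m = \<delta> / 2"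
  proof -
    have "exp (- (?\<epsilon>\<^sup>2 / 4)) ^ m = exp (- (real m * ?\<epsilon>\<^sup>2 / 4))"
      by (simp add: exp_of_nat_mult[symmetric])
    also have "\<dots> = \<delta> / 2"
      using \<delta> by (simp add: \<epsilon>(2) exp_minus)
    finally show ?thesis .
  qed
  have "(1 + ?\<epsilon>) * exp (- ?\<epsilon>) \<le> exp (- (?\<epsilon>\<^sup>2 / (2 * (1 + ?\<epsilon>))))"
    using \<epsilon> by (intro one_plus_mult_exp_minus_le) auto
  also have "\<dots> \<le> exp (- (?\<epsilon>\<^sup>2 / 4))"
    unfolding exp_le_cancel_iff neg_le_iff_le using \<epsilon>(1) small by (intro divide_left_mono) auto
  finally have "((1 + ?\<epsilon>) * exp (- ?\<epsilon>)) ^ m \<le> exp (- (?\<epsilon>\<^sup>2 / 4)) ^ m"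
    using \<epsilon>(1) by (intro power_mono) auto
  moreover have "(1 - ?\<epsilon>) * exp ?\<epsilon> \<le> exp (- (?\<epsilon>\<^sup>2 / 4))"
    by (rule order_trans[OF one_minus_mult_exp_le]) (use \<epsilon>(1) small in auto)
  then have "((1 - ?\<epsilon>) * exp (1 - (1 - ?\<epsilon>))) ^ m \<le> exp (- (?\<epsilon>\<^sup>2 / 4)) ^ m"
    using small by (intro power_mono) auto
  ultimately have "1 - \<delta> \<le> 1 - ((1 + ?\<epsilon>) * exp (- ?\<epsilon>)) ^ m - ((1 - ?\<epsilon>) * exp (1 - (1 - ?\<epsilon>))) ^ m"
    unfolding half by linarith
  then show ?thesis
    using \<epsilon>(1) small \<delta> by (intro cdp_ol_competitive_ratio[OF iid \<theta> m]) auto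
qed

text \<open>The radius need not be small here, only at most 3. The upper tail costs at most 3/4 and
  the lower tail at \<open>x = 1 / 20\<close> at most 3/20, leaving probability 1/10; then
  \<open>1 / 800 = 1 / 10 * (1 / 20 / (1 + 3))\<close>.\<close>

lemma competitive_ratio_large_delta:
  assumes iid: "iid_exponential M X n \<theta>" and \<theta>: "0 < \<theta>" and m: "1 \<le> m" "m < n"
    and \<delta>: "9 / 10 \<le> \<delta>" "\<delta> < 1"
  shows "1 / 800 * (ln (real (n - m)) / (ln (real n) + 1))
    \<le> competitive_ratio M X n (\<lambda>\<omega>. cdp_ol n m \<delta> (\<lambda>t. X t \<omega>))"
proof -
  let ?\<epsilon> = "conf_radius m \<delta>"
  have \<epsilon>: "0 < ?\<epsilon>" "real m * ?\<epsilon>\<^sup>2 = 4 * ln (2 / \<delta>)"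
    using \<delta> m by (auto intro: conf_radius_pos_square)
  have "?\<epsilon>\<^sup>2 \<le> real m * ?\<epsilon>\<^sup>2"
    using m by (intro mult_le_cancel_right1[THEN iffD2]) auto
  also have "\<dots> \<le> 4 * (2 / \<delta> - 1)"
    unfolding \<epsilon>(2) using \<delta> by (intro mult_left_mono ln_le_minus_one) auto
  also have "\<dots> \<le> 3\<^sup>2"
    using \<delta> by (simp add: field_simps)
  finally have \<epsilon>_le: "?\<epsilon> \<le> 3"
    by (rule power2_le_imp_le) simp
  have "(1 + ?\<epsilon>) * exp (- ?\<epsilon>) \<le> exp (- (?\<epsilon>\<^sup>2 / (2 * (1 + ?\<epsilon>))))"
    using \<epsilon> by (intro one_plus_mult_exp_minus_le) auto
  also have "\<dots> \<le> exp (- (?\<epsilon>\<^sup>2 / 8))"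
    unfolding exp_le_cancel_iff neg_le_iff_le using \<epsilon>(1) \<epsilon>_le by (intro divide_left_mono) auto
  finally have "((1 + ?\<epsilon>) * exp (- ?\<epsilon>)) ^ m \<le> exp (- (?\<epsilon>\<^sup>2 / 8)) ^ m"
    using \<epsilon>(1) by (intro power_mono) auto
  also have "\<dots> = exp (- (real m * ?\<epsilon>\<^sup>2 / 8))"
    by (simp add: exp_of_nat_mult[symmetric])
  also have "\<dots> \<le> exp (- (1 / 3))"
  \<comment> \<open>The exponent is half of \<open>ln (2 / \<delta>)\<close>, which is at least
    \<open>ln 2\<close> and hence at least 2/3.\<close>
  proof -
    have "ln 2 \<le> ln (2 / \<delta>)"
      using \<delta> by (intro ln_mono) (auto simp: le_divide_eq)
    then show ?thesis
      unfolding \<epsilon>(2) using ln2_ge_two_thirds by simp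
  qed
  also have "\<dots> \<le> 3 / 4"
    using exp_ge_add_one_self[of "1 / 3"] by (simp add: exp_minus field_simps)
  finally have upper: "((1 + ?\<epsilon>) * exp (- ?\<epsilon>)) ^ m \<le> 3 / 4" .
  have "exp (19 / 20) \<le> (3::real)"
    by (rule order_trans[OF _ exp_le]) simp
  then have e: "1 / 20 * exp (1 - 1 / 20) \<le> (3 / 20 :: real)"
    by simp
  \<comment> \<open>The base is below 1, so \<open>m = 1\<close> is the worst case.\<close>
  have "(1 / 20 * exp (1 - 1 / 20)) ^ m \<le> (1 / 20 * exp (1 - 1 / 20) :: real) ^ 1"
    using m e by (intro power_decreasing) auto
  with e have lower: "(1 / 20 * exp (1 - 1 / 20)) ^ m \<le> (3 / 20 :: real)"
    by simp
  have N: "0 \<le> ln (real (n - m)) / (ln (real n) + 1)"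
    using m by (intro divide_nonneg_nonneg) auto
  have "1 / 800 \<le> 1 / 10 * (1 / 20 / (1 + ?\<epsilon>))"
    using \<epsilon>(1) \<epsilon>_le by (simp add: field_simps)
  then have "1 / 800 * (ln (real (n - m)) / (ln (real n) + 1))
      \<le> 1 / 10 * (1 / 20 / (1 + ?\<epsilon>)) * (ln (real (n - m)) / (ln (real n) + 1))"
    using N by (rule mult_right_mono)
  also have "\<dots> \<le> competitive_ratio M X n (\<lambda>\<omega>. cdp_ol n m \<delta> (\<lambda>t. X t \<omega>))"
  proof (rule cdp_ol_competitive_ratio[OF iid \<theta> m _ _ \<epsilon>(1)])
    show "1 / 10 \<le> 1 - ((1 + ?\<epsilon>) * exp (- ?\<epsilon>)) ^ m - (1 / 20 * exp (1 - 1 / 20)) ^ m"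
      using upper lower by linarith
  qed simp_all
  finally show ?thesis .
qed

section \<open>Asymptotic comparison and conclusion\<close>

text \<open>Exploration costs \<open>ln (n / (n - m)) \<le> m / (n - m) \<le> 2 * m / n\<close> in
  the logarithm, the factor 2 coming from \<open>m \<le> n / 2\<close>. The extra 1 in the bound for
  \<open>OPT\<close> costs the term \<open>1 / ln n\<close>.\<close>

lemma ln_diff_ratio:
  assumes "real m \<le> real n / 2" "0 < ln (real n)"
  shows "1 - 2 * real m / (real n * ln (real n)) - 1 / ln (real n)
    \<le> ln (real (n - m)) / (ln (real n) + 1)"
proof -
  have n: "0 < real n"
    using assms(2) by (cases "n = 0") auto
  have mn: "m < n" "real (n - m) = real n - real m"
    using assms(1) n by (auto simp: of_nat_diff)
  have "ln (real n / (real n - real m)) \<le> real n / (real n - real m) - 1"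
    using assms n by (intro ln_le_minus_one) auto
  also have "\<dots> = real m / (real n - real m)"
    using assms n by (simp add: field_simps)
  also have "\<dots> \<le> real m / (real n / 2)"
    using assms n by (intro divide_left_mono mult_pos_pos) auto
  finally have "ln (real n) - ln (real (n - m)) \<le> 2 * real m / real n"
    using mn n assms by (simp add: ln_div mult.commute)
  then have "(ln (real n) + 1) - ln (real (n - m)) \<le> 1 + 2 * real m / real n"
    by simp
  then have "((ln (real n) + 1) - ln (real (n - m))) / (ln (real n) + 1)
      \<le> (1 + 2 * real m / real n) / (ln (real n) + 1)"
    by (rule divide_right_mono) (use assms(2) in linarith)
  moreover have "(ln (real n) + 1) / (ln (real n) + 1) = 1"
    by (rule divide_self) (use assms(2) in linarith)
  ultimately have "1 - ln (real (n - m)) / (ln (real n) + 1) \<le> (1 + 2 * real m / real n) / (ln (real n) + 1)"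
    by (simp only: diff_divide_distrib)
  also have "\<dots> \<le> (1 + 2 * real m / real n) / ln (real n)"
    by (rule divide_left_mono) (use assms(2) n in \<open>auto intro!: mult_pos_pos add_pos_pos simp del: ln_gt_zero_iff\<close>)
  also have "\<dots> = 2 * real m / (real n * ln (real n)) + 1 / ln (real n)"
    using n by (simp add: add_divide_distrib)
  finally show ?thesis by simp
qed

text \<open>Away from 1, \<open>ln (1 / \<delta>)\<close> is at least 1/1600 and so
  \<open>ln 2 < 1\<close> is at most 1600 times it. Then \<open>4 * 1601 = 6404\<close> is below
  \<open>81\<^sup>2 = 6561\<close>.\<close>

lemma conf_radius_le:
  assumes \<delta>: "0 < \<delta>" "\<delta> \<le> 1 - 1 / 1600"
  shows "conf_radius m \<delta> \<le> 81 * sqrt (ln (1 / \<delta>) / real m)"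
proof -
  have "ln \<delta> \<le> \<delta> - 1"
    using \<delta> by (intro ln_le_minus_one)
  then have "1 \<le> 1600 * ln (1 / \<delta>)"
    using \<delta> by (simp add: ln_div)
  moreover have "ln (2 / \<delta>) = ln 2 + ln (1 / \<delta>)"
    using \<delta> by (simp add: ln_div)
  ultimately have "4 * ln (2 / \<delta>) \<le> 81\<^sup>2 * ln (1 / \<delta>)"
    using ln_2_less_1 by simp
  then have "sqrt (4 * ln (2 / \<delta>) / real m) \<le> sqrt (81\<^sup>2 * (ln (1 / \<delta>) / real m))"
    by (intro real_sqrt_le_mono) (simp add: divide_right_mono)
  then show ?thesis
    unfolding conf_radius_def by (simp only: real_sqrt_mult real_sqrt_abs)
qed

text \<open>When \<open>\<delta>\<close> is bounded away from \<open>1\<close>, \<open>ln (2 / \<delta>)\<close> and \<open>ln (1 / \<delta>)\<close> are comparable and the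
  confidence radius tends to \<open>0\<close>. For \<open>\<delta>\<close> close to \<open>1\<close> this may fail (\<open>m\<close> may even stay bounded),
  but then the factor \<open>1 - \<delta>\<close> is below the constant ratio that the policy always achieves.\<close>

theorem theorem11:
  fixes \<delta> :: "nat \<Rightarrow> real" and m :: "nat \<Rightarrow> nat"
  assumes "\<And>n. 0 < \<delta> n" and "\<And>n. \<delta> n < 1"
    and "(\<lambda>n. real (m n)) \<in> o(\<lambda>n. real n)"
    and "(\<lambda>n. real (m n)) \<in> \<omega>(\<lambda>n. ln (1 / \<delta> n) * (ln (real n))\<^sup>2)"
  shows "\<exists>f g h :: nat \<Rightarrow> real.
      f \<in> O(\<lambda>n. sqrt (ln (1 / \<delta> n) / real (m n))) \<and>
      g \<in> O(\<lambda>n. real (m n) / (real n * ln (real n))) \<and>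
      h \<in> O(\<lambda>n. 1 / ln (real n)) \<and>
      (\<forall>\<^sub>F n in sequentially.
         \<forall>(M :: 'a measure) (X :: nat \<Rightarrow> 'a \<Rightarrow> real) (\<theta> :: real).
           \<theta> > 0 \<longrightarrow> iid_exponential M X n \<theta> \<longrightarrow>
           competitive_ratio M X n (\<lambda>\<omega>. cdp_ol n (m n) (\<delta> n) (\<lambda>t. X t \<omega>))
             \<ge> (1 - \<delta> n) * (1 - f n - g n - h n))"
proof -
  \<comment> \<open>The constant is 2 * 81: the loss
    \<open>1 - (1 - \<epsilon>) / (1 + \<epsilon>)\<close> is at most \<open>2 * \<epsilon>\<close>,
    and 81 comes from \<open>conf_radius_le\<close>.\<close>
  define f where "f = (\<lambda>n. 162 * sqrt (ln (1 / \<delta> n) / real (m n)))"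
  define g where "g = (\<lambda>n. 2 * real (m n) / (real n * ln (real n)))"
  define h where "h = (\<lambda>n::nat. 1 / ln (real n))"
  have f: "f \<in> O(\<lambda>n. sqrt (ln (1 / \<delta> n) / real (m n)))"
    unfolding f_def by (intro landau_o.big.cmult_in_iff[THEN iffD2]) auto
  have "(\<lambda>n. 2 * (real (m n) / (real n * ln (real n)))) \<in> O(\<lambda>n. real (m n) / (real n * ln (real n)))"
    by (intro landau_o.big.cmult_in_iff[THEN iffD2]) auto
  then have g: "g \<in> O(\<lambda>n. real (m n) / (real n * ln (real n)))"
    by (simp add: g_def)
  have h: "h \<in> O(\<lambda>n. 1 / ln (real n))"
    unfolding h_def by (rule landau_o.big_refl)
  have half: "\<forall>\<^sub>F n in sequentially. norm (real (m n)) \<le> 1 / 2 * norm (real n)"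
    using assms(3) by (rule landau_o.smallD) simp
  have omega: "\<forall>\<^sub>F n in sequentially. norm (real (m n)) \<ge> 1 * norm (ln (1 / \<delta> n) * (ln (real n))\<^sup>2)"
    using assms(4) by (rule landau_omega.smallD) simp
  have "filterlim (\<lambda>n::nat. ln (real n)) at_top sequentially"
    by (rule filterlim_compose[OF ln_at_top filterlim_real_sequentially])
  \<comment> \<open>Any bound above 81 makes the confidence radius, at most
    \<open>81 / ln n\<close>, smaller than 1.\<close>
  then have ln_large: "\<forall>\<^sub>F n::nat in sequentially. 82 \<le> ln (real n)"
    by (simp add: filterlim_at_top)
  \<comment> \<open>The three eventual conditions involve only \<open>m\<close>, \<delta> and
    \<open>n\<close>, so the threshold is uniform in \<open>M\<close>, \<open>X\<close> and
    \<theta>.\<close>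
  have "\<forall>\<^sub>F n in sequentially.
         \<forall>(M :: 'a measure) (X :: nat \<Rightarrow> 'a \<Rightarrow> real) (\<theta> :: real).
           \<theta> > 0 \<longrightarrow> iid_exponential M X n \<theta> \<longrightarrow>
           competitive_ratio M X n (\<lambda>\<omega>. cdp_ol n (m n) (\<delta> n) (\<lambda>t. X t \<omega>))
             \<ge> (1 - \<delta> n) * (1 - f n - g n - h n)"
    using half omega ln_large
  proof eventually_elim
    case (elim n)
    define ratio where "ratio = ln (real (n - m n)) / (ln (real n) + 1)"
    note \<delta> = assms(1)[of n] assms(2)[of n]
    have ln_n: "82 \<le> ln (real n)" and m_le: "real (m n) \<le> real n / 2"
      using elim by auto
    have n: "0 < n"
      using ln_n by (cases "n = 0") auto
    have ln_\<delta>: "0 < ln (1 / \<delta> n)"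
      using \<delta> by simp
    \<comment> \<open>Besides controlling the radius, this forces \<open>m n\<close> to be
      positive.\<close>
    then have omega: "ln (1 / \<delta> n) * (ln (real n))\<^sup>2 \<le> real (m n)"
      using elim(2) by (simp add: abs_mult)
    moreover have "0 < ln (1 / \<delta> n) * (ln (real n))\<^sup>2"
      using ln_\<delta> ln_n by simp
    ultimately have "0 < real (m n)"
      by linarith
    then have m: "1 \<le> m n" "m n < n"
      using m_le n by auto
    have "1 - g n - h n \<le> ratio"
      unfolding g_def h_def ratio_def using m_le ln_n by (intro ln_diff_ratio) auto
    moreover have "ratio \<le> 1"
    proof -
      have "ln (real (n - m n)) \<le> ln (real n)"
        using m by simp
      then show ?thesis
        using ln_n by (simp add: ratio_def)
    qed
    ultimately have ratio: "1 - g n - h n \<le> ratio" "ratio \<le> 1"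
      by auto
    have nonneg: "0 \<le> f n" "0 \<le> g n" "0 \<le> h n"
      using ln_n ln_\<delta> by (auto simp: f_def g_def h_def)
    have "g n \<le> h n"
    proof -
      have "g n = 2 * real (m n) / real n * h n"
        by (simp add: g_def h_def)
      also have "\<dots> \<le> 1 * h n"
        using m_le n nonneg by (intro mult_right_mono) auto
      finally show ?thesis by simp
    qed
    moreover have "h n \<le> 1 / 4"
      using ln_n by (simp add: h_def divide_le_eq)
    ultimately have ratio_half: "1 / 2 \<le> ratio"
      using ratio by linarith
    show ?case
    proof (intro allI impI)
      fix M :: "'a measure" and X :: "nat \<Rightarrow> 'a \<Rightarrow> real" and \<theta> :: real
      assume \<theta>: "0 < \<theta>" and iid: "iid_exponential M X n \<theta>"
      let ?CR = "competitive_ratio M X n (\<lambda>\<omega>. cdp_ol n (m n) (\<delta> n) (\<lambda>t. X t \<omega>))"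
      show "(1 - \<delta> n) * (1 - f n - g n - h n) \<le> ?CR"
      proof (cases "\<delta> n \<le> 1 - 1 / 1600")
        case True
        let ?\<epsilon> = "conf_radius (m n) (\<delta> n)"
        have \<epsilon>: "0 < ?\<epsilon>"
          using \<delta> m by (intro conf_radius_pos_square) auto
        have \<epsilon>_le: "?\<epsilon> \<le> 81 * sqrt (ln (1 / \<delta> n) / real (m n))"
          using \<delta>(1) True by (rule conf_radius_le)
        also have "sqrt (ln (1 / \<delta> n) / real (m n)) \<le> 1 / ln (real n)"
        proof (rule real_le_lsqrt)
          show "ln (1 / \<delta> n) / real (m n) \<le> (1 / ln (real n))\<^sup>2"
            using omega m ln_n by (simp add: field_simps)
        qed (use ln_n in auto)
        also have "81 * (1 / ln (real n)) < 1"
          using ln_n by (simp add: divide_less_eq)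
        finally have small: "?\<epsilon> < 1"
          by simp
        define a where "a = (1 - ?\<epsilon>) / (1 + ?\<epsilon>)"
        have "1 - 2 * ?\<epsilon> \<le> a" "a \<le> 1"
          using \<epsilon> by (auto simp: a_def field_simps)
        moreover have "2 * ?\<epsilon> \<le> f n"
          using \<epsilon>_le by (simp add: f_def)
        ultimately have a: "1 - f n \<le> a" "a \<le> 1"
          by auto
        \<comment> \<open>Expanding gives \<open>a * ratio \<ge> a + ratio - 1\<close>, so the
          separate losses add up.\<close>
        have "0 \<le> (1 - a) * (1 - ratio)"
          using a ratio by simp
        then have "1 - f n - g n - h n \<le> a * ratio"
          using a ratio by (simp add: algebra_simps)
        then have "(1 - \<delta> n) * (1 - f n - g n - h n) \<le> (1 - \<delta> n) * (a * ratio)"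
          using \<delta> by (intro mult_left_mono) auto
        also have "\<dots> \<le> ?CR"
          using competitive_ratio_small_conf_radius[OF iid \<theta> m \<delta> small]
          by (simp only: a_def ratio_def mult.assoc)
        finally show ?thesis .
      next
        case False
        have "(1 - \<delta> n) * (1 - f n - g n - h n) \<le> (1 - \<delta> n) * 1"
          using nonneg \<delta> by (intro mult_left_mono) auto
        \<comment> \<open>The threshold 1/1600 is the guaranteed 1/800 times the lower bound 1/2 for
          \<open>ratio\<close>.\<close>
        also have "\<dots> \<le> 1 / 1600"
          using False by simp
        also have "\<dots> \<le> 1 / 800 * ratio"
          using ratio_half by simp
        also have "\<dots> \<le> ?CR"
          unfolding ratio_def using False \<delta>
          by (intro competitive_ratio_large_delta[OF iid \<theta> m]) auto
        finally show ?thesis .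
      qed
    qed
  qed
  with f g h show ?thesis
    by blast
qed

end
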